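(* Let $\Omega\subset\mathbb{R}^3$ be an open bounded domain with polytopal boundary and let $\mathcal{T}$ be a conforming simplicial (tetrahedral) triangulation of $\overline{\Omega}$ with $V$ vertices, $E$ edges, $F$ faces and $T$ tetrahedra, and with $V_b$ boundary vertices, $E_b$ boundary edges and $F_b$ boundary faces. Let $\chi = V-E+F-T$ and $\chi_b = V_b-E_b+F_b$ be the topological constants (Euler characteristics) of $\overline\Omega$ and $\partial\Omega$, and let $\overline{e}=\frac{1}{V}\sum_{i=1}^V e_i$ be the average number of edges emanating from a vertex. Then $$E=\tfrac12\overline{e}\,V,\qquad E_b=3(V_b-\chi_b),$$ $$F=(\overline{e}-2)V-V_b+2\chi+\chi_b,\qquad F_b=2(V_b-\chi_b),$$ $$T=\left(\tfrac12\overline{e}-1\right)V-V_b+\chi+\chi_b.$$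
   Context: A conforming tetrahedral triangulation of $\overline\Omega$ is a finite set of closed non-degenerate tetrahedra whose union is $\overline\Omega$ and such that any two distinct tetrahedra intersect in the empty set, a common vertex, a common edge or a common (triangular) face; it is a pure simplicial $3$-complex. Boundary vertices, edges and faces are those contained in $\partial\Omega$. As standing conventions on the mesh: every boundary face belongs to exactly one tetrahedron, every other face belongs to exactly two tetrahedra, and every boundary edge belongs to exactly two boundary faces (so $2F-F_b=4T$ and $3F_b=2E_b$). For each vertex $v_i$, $i=1,\dots,V$, $e_i$ denotes the number of edges of $\mathcal{T}$ having $v_i$ as an endpoint, so that $\overline{e}=2E/V$. *)

theory Defs
  imports "HOL-Analysis.Analysis"
begin

text \<open>The frontier of an open set has empty interior, so the polytopes below are automatically at
  most two-dimensional; lower-dimensional pieces are not excluded.\<close>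

definition polytopal_boundary :: "(real ^ 3) set \<Rightarrow> bool" where
  "polytopal_boundary \<Omega> \<longleftrightarrow>
     (\<exists>P. finite P \<and> (\<forall>p\<in>P. polytope p) \<and> frontier \<Omega> = \<Union>P)"

definition conforming_triangulation :: "(real ^ 3) set set \<Rightarrow> (real ^ 3) set \<Rightarrow> bool" where
  "conforming_triangulation \<T> S \<longleftrightarrow>
     triangulation \<T> \<and> (\<forall>K\<in>\<T>. 3 simplex K) \<and> \<Union>\<T> = S"

text \<open>The library's \<^const>\<open>triangulation\<close> only says that intersections are faces. For tetrahedra this
  is the usual list of possible intersections.\<close>

lemma conforming_triangulation_iff:
  "conforming_triangulation \<T> S \<longleftrightarrow>
     finite \<T> \<and> (\<forall>K\<in>\<T>. 3 simplex K) \<and> \<Union>\<T> = S \<and>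
     (\<forall>K\<in>\<T>. \<forall>L\<in>\<T>. K \<noteq> L \<longrightarrow>
        K \<inter> L = {} \<or>
        (\<exists>v. K \<inter> L = {v} \<and> v extreme_point_of K \<and> v extreme_point_of L) \<or>
        ((K \<inter> L) edge_of K \<and> (K \<inter> L) edge_of L) \<or>
        ((K \<inter> L) facet_of K \<and> (K \<inter> L) facet_of L))"
    (is "_ \<longleftrightarrow> ?fin \<and> ?tet \<and> ?un \<and> ?int")
proof
  assume conf: "conforming_triangulation \<T> S"
  then have tri: "triangulation \<T>" and tet: ?tet and un: ?un
    by (auto simp: conforming_triangulation_def)
  have ?int
  proof (intro ballI impI)
    fix K L assume K: "K \<in> \<T>" and L: "L \<in> \<T>" and "K \<noteq> L"
    have face: "(A \<inter> B) face_of A" if "A \<in> \<T>" "B \<in> \<T>" for A B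
      using tri that by (simp add: triangulation_def)
    have fK: "(K \<inter> L) face_of K" and fL: "(K \<inter> L) face_of L"
      using face[OF K L] face[OF L K] by (simp_all add: Int_commute)
    have dK: "aff_dim K = 3" and dL: "aff_dim L = 3"
      using tet K L aff_dim_simplex by blast+
    have "convex K" "convex L"
      using tet K L convex_simplex by blast+
    have "aff_dim (K \<inter> L) < 3"
    proof (cases "K \<inter> L = K")
      case True
      then have "K \<inter> L \<noteq> L" using \<open>K \<noteq> L\<close> by blast
      then show ?thesis using face_of_aff_dim_lt[OF \<open>convex L\<close> fL] dL by simp
    next
      case False
      then show ?thesis using face_of_aff_dim_lt[OF \<open>convex K\<close> fK] dK by simp
    qed
    moreover have "aff_dim (K \<inter> L) \<ge> -1" by (rule aff_dim_geq)
    ultimately consider "aff_dim (K \<inter> L) = -1" | "aff_dim (K \<inter> L) = 0"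
      | "aff_dim (K \<inter> L) = 1" | "aff_dim (K \<inter> L) = 2" by linarith
    then show "K \<inter> L = {} \<or>
        (\<exists>v. K \<inter> L = {v} \<and> v extreme_point_of K \<and> v extreme_point_of L) \<or>
        ((K \<inter> L) edge_of K \<and> (K \<inter> L) edge_of L) \<or>
        ((K \<inter> L) facet_of K \<and> (K \<inter> L) facet_of L)"
    proof cases
      case 1
      then show ?thesis using aff_dim_empty[of "K \<inter> L"] by metis
    next
      case 2
      then obtain v where "K \<inter> L = {v}" using aff_dim_eq_0[of "K \<inter> L"] by metis
      then show ?thesis using fK fL face_of_singleton[of v] by metis
    next
      case 3
      then show ?thesis using fK fL unfolding edge_of_def by metis
    next
      case 4
      then have "K \<inter> L \<noteq> {}" using aff_dim_empty[of "K \<inter> L"] by linarith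
      then have "(K \<inter> L) facet_of K" "(K \<inter> L) facet_of L"
        using 4 fK fL dK dL unfolding facet_of_def by linarith+
      then show ?thesis by metis
    qed
  qed
  then show "?fin \<and> ?tet \<and> ?un \<and> ?int"
    using tri tet un unfolding triangulation_def by metis
next
  assume "?fin \<and> ?tet \<and> ?un \<and> ?int"
  then have fin: ?fin and tet: ?tet and un: ?un and int: ?int by metis+
  have "(K \<inter> L) face_of K" if K: "K \<in> \<T>" and L: "L \<in> \<T>" for K L
  proof (cases "K = L")
    case True
    then show ?thesis using tet K convex_simplex face_of_refl by (metis Int_absorb)
  next
    case False
    then consider "K \<inter> L = {}" | v where "K \<inter> L = {v}" "v extreme_point_of K"
      | "(K \<inter> L) edge_of K" | "(K \<inter> L) facet_of K"
      using int[rule_format, OF K L False] by metis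
    then show ?thesis
      by cases (metis empty_face_of, metis face_of_singleton, metis edge_of_def, metis facet_of_def)
  qed
  then show "conforming_triangulation \<T> S"
    using fin tet un unfolding conforming_triangulation_def triangulation_def by metis
qed

definition mesh_vertices :: "(real ^ 3) set set \<Rightarrow> (real ^ 3) set" where
  "mesh_vertices \<T> = {v. \<exists>K\<in>\<T>. v extreme_point_of K}"

definition mesh_edges :: "(real ^ 3) set set \<Rightarrow> (real ^ 3) set set" where
  "mesh_edges \<T> = {e. \<exists>K\<in>\<T>. e edge_of K}"

definition mesh_faces :: "(real ^ 3) set set \<Rightarrow> (real ^ 3) set set" where
  "mesh_faces \<T> = {f. \<exists>K\<in>\<T>. f facet_of K}"

definition boundary_vertices :: "(real ^ 3) set set \<Rightarrow> (real ^ 3) set \<Rightarrow> (real ^ 3) set" where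
  "boundary_vertices \<T> \<Omega> = {v \<in> mesh_vertices \<T>. v \<in> frontier \<Omega>}"

definition boundary_edges :: "(real ^ 3) set set \<Rightarrow> (real ^ 3) set \<Rightarrow> (real ^ 3) set set" where
  "boundary_edges \<T> \<Omega> = {e \<in> mesh_edges \<T>. e \<subseteq> frontier \<Omega>}"

definition boundary_faces :: "(real ^ 3) set set \<Rightarrow> (real ^ 3) set \<Rightarrow> (real ^ 3) set set" where
  "boundary_faces \<T> \<Omega> = {f \<in> mesh_faces \<T>. f \<subseteq> frontier \<Omega>}"

definition vertex_degree :: "(real ^ 3) set set \<Rightarrow> real ^ 3 \<Rightarrow> nat" where
  "vertex_degree \<T> v = card {e \<in> mesh_edges \<T>. v extreme_point_of e}"

definition average_degree :: "(real ^ 3) set set \<Rightarrow> real" where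
  "average_degree \<T> =
     (\<Sum>v\<in>mesh_vertices \<T>. real (vertex_degree \<T> v)) / real (card (mesh_vertices \<T>))"

end

theory Submission
  imports Defs
begin

text \<open>
  The identities are linear algebra in the numbers $V, E, F, T, V_b, E_b, F_b$, once three incidence
  relations are counted in two ways. Counting vertex--edge incidences from the edges, each of which
  has two end points, gives $\sum_v e_v = 2E$. Counting face--tetrahedron incidences from the
  tetrahedra, each of which has four facets, and from the faces, of which those on the boundary lie
  in one tetrahedron and the others in two, gives $4T = 2F - F_b$. Counting edge--face incidences on
  the boundary surface, where every face has three edges and every edge lies in two faces, gives
  $3F_b = 2E_b$. Substituting these into the definitions of $\chi$ and $\chi_b$ and solving for
  $E, F, T, E_b, F_b$ yields the claim.

  The numbers two, four and three have one source: the faces of a simplex are exactly the simplices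
  spanned by subsets of its vertices. Hence every face is again a simplex (\<open>face_of_simplex\<close>), an
  $n$-simplex has $n+1$ extreme points (\<open>card_extreme_points_simplex\<close>), and it has
  $\binom{n+1}{k+1}$ faces of dimension $k$ (\<open>card_faces_simplex\<close>). Since a face of a face is a
  face, the end points of a mesh edge are mesh vertices and the edges of a boundary face are boundary
  edges, so none of these cells escapes the counts.
\<close>

section \<open>Faces of a simplex\<close>

lemma face_of_simplex:
  assumes S: "n simplex S" and f: "f face_of S" and dim: "aff_dim f = k"
  shows "k simplex f"
proof -
  obtain C where C: "\<not> affine_dependent C" "S = convex hull C"
    using S unfolding simplex_def by blast
  then obtain c where c: "c \<subseteq> C" "f = convex hull c"
    using f face_of_convex_hull_affine_independent[OF C(1)] by auto
  have indep: "\<not> affine_dependent c"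
    using C(1) c(1) by (rule affine_independent_subset)
  then have "int (card c) = k + 1"
    using aff_dim_affine_independent[OF indep] dim c by (simp add: aff_dim_convex_hull)
  with indep c show ?thesis
    unfolding simplex_def by blast
qed

lemma card_extreme_points_simplex:
  assumes "n simplex S"
  shows "int (card {v. v extreme_point_of S}) = n + 1"
proof -
  obtain C where C: "\<not> affine_dependent C" "int (card C) = n + 1" "S = convex hull C"
    using assms unfolding simplex_def by blast
  then have "{v. v extreme_point_of S} = C"
    using extreme_point_of_convex_hull_affine_independent[OF C(1)] by simp
  with C(2) show ?thesis by simp
qed

text \<open>Taking convex hulls is a bijection from the $(k+1)$-element subsets of the vertex set onto
  the $k$-dimensional faces; its inverse takes the extreme points.\<close>

lemma card_faces_simplex:
  fixes S :: "'a::euclidean_space set"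
  assumes "int n simplex S"
  shows "card {f. f face_of S \<and> aff_dim f = int k} = (n + 1) choose (k + 1)"
proof -
  obtain C where C: "\<not> affine_dependent C" "int (card C) = int n + 1" "S = convex hull C"
    using assms unfolding simplex_def by blast
  have fin: "finite C"
    using C(1) by (rule aff_independent_finite)
  have indep: "\<not> affine_dependent c" if "c \<subseteq> C" for c
    using C(1) that by (rule affine_independent_subset)
  have dim: "aff_dim (convex hull c) = int (card c) - 1" if "c \<subseteq> C" for c
    using aff_dim_affine_independent[OF indep[OF that]] by (simp add: aff_dim_convex_hull)
  let ?sub = "{c. c \<subseteq> C \<and> card c = k + 1}"
  have "{f. f face_of S \<and> aff_dim f = int k} = (\<lambda>c. convex hull c) ` ?sub"
  proof (intro equalityI subsetI)
    fix f assume "f \<in> {f. f face_of S \<and> aff_dim f = int k}"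
    then obtain c where c: "c \<subseteq> C" "f = convex hull c" "aff_dim f = int k"
      using face_of_convex_hull_affine_independent[OF C(1)] C(3) by auto
    with dim[OF c(1)] show "f \<in> (\<lambda>c. convex hull c) ` ?sub"
      by auto
  next
    fix f assume "f \<in> (\<lambda>c. convex hull c) ` ?sub"
    then obtain c where c: "c \<subseteq> C" "card c = k + 1" "f = convex hull c"
      by blast
    then have "f face_of S"
      using face_of_convex_hull_affine_independent[OF C(1)] C(3) by blast
    with c dim[OF c(1)] show "f \<in> {f. f face_of S \<and> aff_dim f = int k}"
      by simp
  qed
  moreover have "inj_on (\<lambda>c. convex hull c) ?sub"
  proof (rule inj_on_inverseI[where g = "\<lambda>f. {v. v extreme_point_of f}"])
    fix c assume "c \<in> ?sub"
    then show "{v. v extreme_point_of (convex hull c)} = c"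
      using extreme_point_of_convex_hull_affine_independent[OF indep[of c]] by auto
  qed
  ultimately have "card {f. f face_of S \<and> aff_dim f = int k} = card ?sub"
    by (simp add: card_image)
  also have "\<dots> = card C choose (k + 1)"
    using fin by (rule n_subsets)
  finally show ?thesis using C(2) by (metis of_nat_1 of_nat_add of_nat_eq_iff)
qed

lemma card_facets_tetrahedron:
  fixes K :: "(real ^ 3) set"
  assumes "3 simplex K"
  shows "card {f. f facet_of K} = 4"
proof -
  have "{f. f facet_of K} = {f. f face_of K \<and> aff_dim f = int 2}"
    using aff_dim_simplex[OF assms] unfolding facet_of_def by auto
  moreover have "card {f. f face_of K \<and> aff_dim f = int 2} = (3 + 1) choose (2 + 1)"
    by (rule card_faces_simplex) (use assms in simp)
  ultimately show ?thesis by (simp add: numeral_eq_Suc)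
qed

lemma card_edges_triangle:
  fixes f :: "(real ^ 3) set"
  assumes "2 simplex f"
  shows "card {e. e edge_of f} = 3"
proof -
  have "card {e. e face_of f \<and> aff_dim e = int 1} = (2 + 1) choose (1 + 1)"
    by (rule card_faces_simplex) (use assms in simp)
  then show ?thesis by (simp add: edge_of_def numeral_eq_Suc)
qed

section \<open>Cells of a conforming mesh\<close>

lemma facet_of_tetrahedron_triangle:
  assumes K: "3 simplex K" and f: "f facet_of K"
  shows "2 simplex f"
proof (rule face_of_simplex[OF K])
  show "f face_of K" "aff_dim f = 2"
    using f aff_dim_simplex[OF K] by (simp_all add: facet_of_def)
qed

lemma finite_mesh_cells:
  assumes "conforming_triangulation \<T> S"
  shows "finite (mesh_vertices \<T>)" "finite (mesh_edges \<T>)" "finite (mesh_faces \<T>)"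
proof -
  have fin: "finite \<T>" and tet: "\<And>K. K \<in> \<T> \<Longrightarrow> 3 simplex K"
    using assms by (auto simp: conforming_triangulation_def triangulation_def)
  have faces: "finite {f. f face_of K}" if "K \<in> \<T>" for K
    using tet[OF that] by (simp add: finite_polytope_faces simplex_imp_polytope)
  have "finite (\<Union>K\<in>\<T>. {e. e edge_of K})"
    using fin faces by (auto simp: edge_of_def)
  then show "finite (mesh_edges \<T>)"
    by (simp add: mesh_edges_def Collect_bex_eq)
  have "finite (\<Union>K\<in>\<T>. {f. f facet_of K})"
    using fin faces by (auto simp: facet_of_def)
  then show "finite (mesh_faces \<T>)"
    by (simp add: mesh_faces_def Collect_bex_eq)
  have "finite {v. v extreme_point_of K}" if "K \<in> \<T>" for K
    using tet[OF that] by (simp add: finite_polyhedron_extreme_points simplex_imp_polyhedron)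
  then have "finite (\<Union>K\<in>\<T>. {v. v extreme_point_of K})"
    using fin by blast
  then show "finite (mesh_vertices \<T>)"
    by (simp add: mesh_vertices_def Collect_bex_eq)
qed

section \<open>Double counting of incidences\<close>

text \<open>Both end points of a mesh edge are mesh vertices, so each edge contributes exactly two to the
  sum of the degrees.\<close>

lemma sum_vertex_degree:
  assumes mesh: "conforming_triangulation \<T> S"
  shows "(\<Sum>v\<in>mesh_vertices \<T>. vertex_degree \<T> v) = 2 * card (mesh_edges \<T>)"
  unfolding vertex_degree_def
proof (rule sum_multicount)
  show "\<forall>e\<in>mesh_edges \<T>. card {v \<in> mesh_vertices \<T>. v extreme_point_of e} = 2"
  proof
    fix e assume "e \<in> mesh_edges \<T>"
    then obtain K where K: "K \<in> \<T>" and e: "e face_of K" "aff_dim e = 1"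
      unfolding mesh_edges_def edge_of_def by blast
    have tet: "3 simplex K"
      using mesh K by (simp add: conforming_triangulation_def)
    have "{v \<in> mesh_vertices \<T>. v extreme_point_of e} = {v. v extreme_point_of e}"
      using K extreme_point_of_face[OF e(1)] unfolding mesh_vertices_def by blast
    then show "card {v \<in> mesh_vertices \<T>. v extreme_point_of e} = 2"
      using card_extreme_points_simplex[OF face_of_simplex[OF tet e]] by simp
  qed
qed (use finite_mesh_cells[OF mesh] in simp_all)

text \<open>The set $B$ collects the faces that lie in only one tetrahedron. Counting face--tetrahedron
  pairs, such a face contributes one and any other face two, so the total falls short of twice the
  number of faces by the size of $B$.\<close>

lemma four_tetrahedra_eq:
  assumes mesh: "conforming_triangulation \<T> S"
    and B: "B \<subseteq> mesh_faces \<T>"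
    and one: "\<And>f. f \<in> B \<Longrightarrow> card {K \<in> \<T>. f facet_of K} = 1"
    and two: "\<And>f. f \<in> mesh_faces \<T> - B \<Longrightarrow> card {K \<in> \<T>. f facet_of K} = 2"
  shows "4 * card \<T> + card B = 2 * card (mesh_faces \<T>)"
proof -
  have fin: "finite \<T>" and finF: "finite (mesh_faces \<T>)"
    using mesh finite_mesh_cells[OF mesh]
    by (auto simp: conforming_triangulation_def triangulation_def)
  have "(\<Sum>f\<in>mesh_faces \<T>. card {K \<in> \<T>. f facet_of K}) = 4 * card \<T>"
  proof (rule sum_multicount)
    show "\<forall>K\<in>\<T>. card {f \<in> mesh_faces \<T>. f facet_of K} = 4"
    proof
      fix K assume K: "K \<in> \<T>"
      then have "{f \<in> mesh_faces \<T>. f facet_of K} = {f. f facet_of K}"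
        unfolding mesh_faces_def by blast
      then show "card {f \<in> mesh_faces \<T>. f facet_of K} = 4"
        using K mesh card_facets_tetrahedron by (simp add: conforming_triangulation_def)
    qed
  qed (use fin finF in simp_all)
  moreover have "(\<Sum>f\<in>mesh_faces \<T>. card {K \<in> \<T>. f facet_of K})
      = (\<Sum>f\<in>mesh_faces \<T> - B. card {K \<in> \<T>. f facet_of K})
        + (\<Sum>f\<in>B. card {K \<in> \<T>. f facet_of K})"
    using finF B by (rule sum.subset_diff[rotated])
  moreover have "(\<Sum>f\<in>mesh_faces \<T> - B. card {K \<in> \<T>. f facet_of K})
      = 2 * card (mesh_faces \<T> - B)"
    using two by simp
  moreover have "(\<Sum>f\<in>B. card {K \<in> \<T>. f facet_of K}) = card B"
    using one by simp
  moreover have "card (mesh_faces \<T> - B) + card B = card (mesh_faces \<T>)"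
    using B finF by (metis add.commute card_Diff_subset card_mono finite_subset le_add_diff_inverse)
  ultimately show ?thesis by linarith
qed

text \<open>An edge of a boundary face is contained in that face, hence in the frontier. So all three of
  its edges are boundary edges, and each boundary edge is met from its two boundary faces.\<close>

lemma three_boundary_faces_eq:
  assumes mesh: "conforming_triangulation \<T> S"
    and two: "\<And>e. e \<in> boundary_edges \<T> \<Omega> \<Longrightarrow> card {f \<in> boundary_faces \<T> \<Omega>. e edge_of f} = 2"
  shows "3 * card (boundary_faces \<T> \<Omega>) = 2 * card (boundary_edges \<T> \<Omega>)"
proof -
  have "(\<Sum>f\<in>boundary_faces \<T> \<Omega>. card {e \<in> boundary_edges \<T> \<Omega>. e edge_of f})
      = 2 * card (boundary_edges \<T> \<Omega>)"
    by (rule sum_multicount)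
      (use two finite_mesh_cells[OF mesh] in
        \<open>auto simp: boundary_faces_def boundary_edges_def\<close>)
  moreover have "card {e \<in> boundary_edges \<T> \<Omega>. e edge_of f} = 3"
    if f: "f \<in> boundary_faces \<T> \<Omega>" for f
  proof -
    obtain K where K: "K \<in> \<T>" "f facet_of K" and fr: "f \<subseteq> frontier \<Omega>"
      using f unfolding boundary_faces_def mesh_faces_def by blast
    have tet: "3 simplex K"
      using mesh K by (simp add: conforming_triangulation_def)
    have "e \<in> boundary_edges \<T> \<Omega>" if e: "e edge_of f" for e
    proof -
      have "e edge_of K"
        using e K(2) unfolding edge_of_def facet_of_def by (blast intro: face_of_trans)
      moreover have "e \<subseteq> frontier \<Omega>"
        using e fr face_of_imp_subset unfolding edge_of_def by blast
      ultimately show ?thesis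
        using K(1) unfolding boundary_edges_def mesh_edges_def by blast
    qed
    then have "{e \<in> boundary_edges \<T> \<Omega>. e edge_of f} = {e. e edge_of f}"
      by blast
    then show ?thesis
      using card_edges_triangle[OF facet_of_tetrahedron_triangle[OF tet K(2)]] by simp
  qed
  ultimately show ?thesis by simp
qed

section \<open>The counting formulas\<close>

theorem proposition4:
  fixes \<Omega> :: "(real ^ 3) set" and \<T> :: "(real ^ 3) set set"
    and V E F T V\<^sub>b E\<^sub>b F\<^sub>b :: nat and chi chi\<^sub>b :: int and avg :: real
  assumes domain: "open \<Omega>" "connected \<Omega>" "\<Omega> \<noteq> {}" "bounded \<Omega>" "polytopal_boundary \<Omega>"
    and mesh: "conforming_triangulation \<T> (closure \<Omega>)"
    and boundary_face: "\<And>f. f \<in> boundary_faces \<T> \<Omega> \<Longrightarrow> card {K \<in> \<T>. f facet_of K} = 1"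
    and other_face: "\<And>f. f \<in> mesh_faces \<T> - boundary_faces \<T> \<Omega> \<Longrightarrow> card {K \<in> \<T>. f facet_of K} = 2"
    and boundary_edge: "\<And>e. e \<in> boundary_edges \<T> \<Omega> \<Longrightarrow> card {f \<in> boundary_faces \<T> \<Omega>. e edge_of f} = 2"
    and V: "V = card (mesh_vertices \<T>)"
    and E: "E = card (mesh_edges \<T>)"
    and F: "F = card (mesh_faces \<T>)"
    and T: "T = card \<T>"
    and V\<^sub>b: "V\<^sub>b = card (boundary_vertices \<T> \<Omega>)"
    and E\<^sub>b: "E\<^sub>b = card (boundary_edges \<T> \<Omega>)"
    and F\<^sub>b: "F\<^sub>b = card (boundary_faces \<T> \<Omega>)"
    and chi: "chi = int V - int E + int F - int T"
    and chi\<^sub>b: "chi\<^sub>b = int V\<^sub>b - int E\<^sub>b + int F\<^sub>b"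
    and avg: "avg = average_degree \<T>"
  shows "real E = 1/2 * avg * real V \<and>
         int E\<^sub>b = 3 * (int V\<^sub>b - chi\<^sub>b) \<and>
         real F = (avg - 2) * real V - real V\<^sub>b + 2 * real_of_int chi + real_of_int chi\<^sub>b \<and>
         int F\<^sub>b = 2 * (int V\<^sub>b - chi\<^sub>b) \<and>
         real T = (1/2 * avg - 1) * real V - real V\<^sub>b + real_of_int chi + real_of_int chi\<^sub>b"
proof -
  \<comment> \<open>If there were no vertices, the sum would be empty, so division by zero does no harm.\<close>
  have "avg * real V = (\<Sum>v\<in>mesh_vertices \<T>. real (vertex_degree \<T> v))"
    unfolding avg V average_degree_def using finite_mesh_cells(1)[OF mesh] by auto
  also have "\<dots> = 2 * real E"
    using sum_vertex_degree[OF mesh] unfolding E by (simp flip: of_nat_sum)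
  finally have edges: "avg * real V = 2 * real E" .
  have "boundary_faces \<T> \<Omega> \<subseteq> mesh_faces \<T>"
    by (auto simp: boundary_faces_def)
  then have "4 * T + F\<^sub>b = 2 * F"
    unfolding T F F\<^sub>b using mesh boundary_face other_face by (intro four_tetrahedra_eq)
  then have tets: "4 * int T + int F\<^sub>b = 2 * int F" by linarith
  have "3 * F\<^sub>b = 2 * E\<^sub>b"
    unfolding F\<^sub>b E\<^sub>b using mesh boundary_edge by (rule three_boundary_faces_eq)
  then have bdry: "3 * int F\<^sub>b = 2 * int E\<^sub>b" by linarith
  have F\<^sub>b_eq: "int F\<^sub>b = 2 * (int V\<^sub>b - chi\<^sub>b)"
    using bdry chi\<^sub>b by simp
  have E\<^sub>b_eq: "int E\<^sub>b = 3 * (int V\<^sub>b - chi\<^sub>b)"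
    using bdry chi\<^sub>b by simp
  have T_int: "int T = int E - int V - int V\<^sub>b + chi + chi\<^sub>b"
    using tets F\<^sub>b_eq chi by simp
  then have T_eq: "real T = real E - real V - real V\<^sub>b + real_of_int chi + real_of_int chi\<^sub>b"
    by linarith
  have "int F = 2 * int E - 2 * int V - int V\<^sub>b + 2 * chi + chi\<^sub>b"
    using T_int chi by simp
  then have F_eq:
    "real F = 2 * real E - 2 * real V - real V\<^sub>b + 2 * real_of_int chi + real_of_int chi\<^sub>b"
    by linarith
  from edges E\<^sub>b_eq F\<^sub>b_eq T_eq F_eq show ?thesis
    by (simp add: algebra_simps)
qed

end
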